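(* Let $n\ge 2$ and let $V\subset\mathbb{C}^n$ be an unbounded subset. Suppose that $V$ has a unique tangent cone at infinity $C_\infty(V)$ and that this cone lies in an algebraic region $\tilde\Omega\subset\mathbb{C}^n$ of type $(k,n)$. Then there exists an algebraic region $\Omega\subset\mathbb{C}^n$ of type $(k,n)$ such that $V\subset\Omega$ and $C_\infty(V)\subset\Omega$.
   Context: Algebraic region. Let $n\ge2$. A set $\Omega\subset\mathbb{C}^n$ is called an algebraic region of type $(k,n)$ if there exist complex vector subspaces $V_1,V_2\subset\mathbb{C}^n$ and positive real numbers $A,B$ such that $\dim V_1=k$, $\dim V_2=n-k$, $\mathbb{C}^n=V_1+V_2$, and $\Omega$ consists of exactly those $z\in\mathbb{C}^n$ for which $\|z''\|\le A(1+\|z'\|)^B$, where $z=z'+z''$ with $z'\in V_1$ and $z''\in V_2$. Tangent cones at infinity. Let $V\subset\mathbb{C}^n$ be an unbounded subset and let $T=\{t_j\}_{j\in\mathbb{N}}$ be a sequence of positive real numbers with $\lim_{j\to\infty}t_j=\infty$. A vector $v\in\mathbb{C}^n$ is tangent to $V$ at infinity with respect to $T$ if there is a sequence $\{x_j\}_{j\in\mathbb{N}}\subset V$ with $\lim_{j\to\infty}\frac{1}{t_j}x_j=v$. Let $E_T(V)$ be the set of all such $v$; each $E_T(V)$ is called a tangent cone of $V$ at infinity. $V$ has a unique tangent cone at infinity if $E_T(V)$ is the same set for all such sequences $T$; this common set is denoted $C_\infty(V)$. *)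

theory Defs
  imports "HOL-Analysis.Analysis"
begin

text \<open>
  Complex \<open>n\<close>-space is \<^typ>\<open>complex ^ 'n\<close> with \<open>n = CARD('n)\<close> and the Euclidean norm.
  The constants \<open>vec.subspace\<close> and \<open>vec.dim\<close> refer to the scalar multiplication \<open>*s\<close>, so here
  they mean complex subspaces and complex dimension (plain \<open>subspace\<close> and \<open>dim\<close> are the real notions).
\<close>

definition algebraic_region :: "nat \<Rightarrow> (complex ^ 'n::finite) set \<Rightarrow> bool" where
  "algebraic_region k \<Omega> \<longleftrightarrow>
     (\<exists>V1 V2 :: (complex ^ 'n) set. \<exists>A B :: real.
        vec.subspace V1 \<and> vec.subspace V2 \<and> A > 0 \<and> B > 0 \<and>
        vec.dim V1 = k \<and> vec.dim V2 = CARD('n) - k \<and>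
        {z' + z'' | z' z''. z' \<in> V1 \<and> z'' \<in> V2} = UNIV \<and>
        \<Omega> = {z' + z'' | z' z''. z' \<in> V1 \<and> z'' \<in> V2 \<and>
                               norm z'' \<le> A * (1 + norm z') powr B})"

definition scaling_seq :: "(nat \<Rightarrow> real) \<Rightarrow> bool" where
  "scaling_seq T \<longleftrightarrow> (\<forall>j. T j > 0) \<and> filterlim T at_top sequentially"

definition tangent_cone_infty :: "(nat \<Rightarrow> real) \<Rightarrow> (complex ^ 'n::finite) set \<Rightarrow> (complex ^ 'n) set" where
  "tangent_cone_infty T V =
     {v. \<exists>x. (\<forall>j. x j \<in> V) \<and> (\<lambda>j. (1 / T j) *\<^sub>R x j) \<longlonglongrightarrow> v}"

definition has_unique_tangent_cone_infty :: "(complex ^ 'n::finite) set \<Rightarrow> bool" where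
  "has_unique_tangent_cone_infty V \<longleftrightarrow>
     (\<forall>S T. scaling_seq S \<longrightarrow> scaling_seq T \<longrightarrow> tangent_cone_infty S V = tangent_cone_infty T V)"

text \<open>Meaningful only if the tangent cone at infinity is unique.\<close>

definition C_infty :: "(complex ^ 'n::finite) set \<Rightarrow> (complex ^ 'n) set" where
  "C_infty V = (THE C. \<forall>T. scaling_seq T \<longrightarrow> tangent_cone_infty T V = C)"

lemma scaling_seq_Suc: "scaling_seq (\<lambda>j. real (Suc j))"
  unfolding scaling_seq_def
  using filterlim_compose[OF filterlim_real_sequentially filterlim_Suc] by simp

lemma C_infty_eq:
  assumes "has_unique_tangent_cone_infty V" and "scaling_seq T"
  shows "C_infty V = tangent_cone_infty T V"
  unfolding C_infty_def
proof (rule the_equality)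
  show "\<forall>S. scaling_seq S \<longrightarrow> tangent_cone_infty S V = tangent_cone_infty T V"
    using assms unfolding has_unique_tangent_cone_infty_def by blast
qed (use assms(2) in blast)

end

theory Submission imports Defs begin

text \<open>
  The cone \<open>C\<close> at infinity is invariant under positive scaling, so its inclusion in
  the given region forces \<open>C \<inter> V2 = {0}\<close>: on a ray in \<open>V2\<close> the
  growth bound reads \<open>\<parallel>z''\<parallel> \<le> A\<close>. If \<open>\<parallel>z''\<parallel> \<le> K (1 + \<parallel>z'\<parallel>)\<close> failed on \<open>V\<close> for
  every \<open>K\<close>, there would be points of \<open>V\<close> with \<open>\<parallel>z''\<parallel> > j (1 + \<parallel>z'\<parallel>)\<close>; rescaling
  them by \<open>t = \<parallel>z''\<parallel>\<close> and passing to a subsequence yields a unit vector in \<open>C \<inter> V2\<close>, a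
  contradiction. So \<open>V\<close> satisfies a linear bound, and raising the constants \<open>A\<close> and \<open>B\<close> gives a
  region containing both sets.
\<close>

text \<open>The dimension formula for sums leaves dimension 0 for the intersection.\<close>

lemma subspace_Int_trivial_of_complementary_dim:
  fixes V1 V2 :: "(complex ^ 'n::finite) set"
  assumes V1: "vec.subspace V1" and V2: "vec.subspace V2"
    and dim: "vec.dim V2 = CARD('n) - vec.dim V1"
    and sum: "{x + y | x y. x \<in> V1 \<and> y \<in> V2} = UNIV"
  shows "V1 \<inter> V2 = {0}"
proof -
  \<comment> \<open>This bound makes the truncated subtraction in \<open>dim\<close> a true
    difference.\<close>
  have "vec.dim V1 \<le> CARD('n)"
    using vec.dim_subset[of V1 UNIV] by (simp add: vec_dim_card del: vec.dim_UNIV)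
  moreover have "vec.dim {x + y | x y. x \<in> V1 \<and> y \<in> V2} + vec.dim (V1 \<inter> V2)
      = vec.dim V1 + vec.dim V2"
    by (rule vec.dim_sums_Int[OF V1 V2])
  ultimately have "vec.dim (V1 \<inter> V2) = 0"
    unfolding sum dim by (simp add: vec_dim_card del: vec.dim_UNIV)
  then show ?thesis
    using vec.subspace_0[OF V1] vec.subspace_0[OF V2] by auto
qed

text \<open>Gives complex subspaces access to facts on real ones: closedness and stability under
  \<open>*\<^sub>R\<close>.\<close>

lemma subspace_of_complex_subspace:
  fixes W :: "(complex ^ 'n::finite) set"
  assumes "vec.subspace W"
  shows "subspace W"
proof -
  have "c *\<^sub>R x = complex_of_real c *s x" for c and x :: "complex ^ 'n"
    unfolding vec_eq_iff vector_scaleR_component vector_smult_component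
    by (simp add: scaleR_conv_of_real)
  then show ?thesis
    using assms unfolding subspace_def vec.subspace_def by simp
qed

text \<open>Dividing the scaling sequence by \<open>t\<close> multiplies limits of the same points
  by \<open>t\<close>; by uniqueness the new sequence has the same cone.\<close>

lemma C_infty_scale:
  assumes uniq: "has_unique_tangent_cone_infty V" and v: "v \<in> C_infty V" and t: "t > 0"
  shows "t *\<^sub>R v \<in> C_infty V"
proof -
  define S where "S j = real (Suc j) / t" for j
  have "LIM j sequentially. (1 / t) * real (Suc j) :> at_top"
    using scaling_seq_Suc t unfolding scaling_seq_def
    by (intro filterlim_tendsto_pos_mult_at_top[OF tendsto_const]) auto
  then have S: "scaling_seq S"
    using t unfolding scaling_seq_def S_def by simp
  obtain x where x: "\<And>j. x j \<in> V" "(\<lambda>j. (1 / real (Suc j)) *\<^sub>R x j) \<longlonglongrightarrow> v"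
    using v unfolding C_infty_eq[OF uniq scaling_seq_Suc] tangent_cone_infty_def by blast
  have "(\<lambda>j. (1 / S j) *\<^sub>R x j) \<longlonglongrightarrow> t *\<^sub>R v"
    using tendsto_scaleR[OF tendsto_const[of t] x(2)] by (simp add: S_def)
  then show ?thesis
    using x(1) unfolding C_infty_eq[OF uniq S] tangent_cone_infty_def by blast
qed

text \<open>The summand 1 in \<open>growth\<close> forces the norms of the chosen \<open>y\<close>
  to infinity, so they can serve as scaling factors; the factor \<open>j\<close> makes the
  \<open>x\<close> parts negligible against them.\<close>

lemma tangent_vector_of_superlinear_growth:
  fixes V V1 V2 :: "(complex ^ 'n::finite) set"
  assumes uniq: "has_unique_tangent_cone_infty V" and V2: "vec.subspace V2"
    and growth: "\<And>j::nat. \<exists>x\<in>V1. \<exists>y\<in>V2. x + y \<in> V \<and> norm y > j * (1 + norm x)"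
  shows "\<exists>u \<in> C_infty V \<inter> V2. norm u = 1"
proof -
  obtain x y where xy: "\<And>j. y j \<in> V2" "\<And>j. x j + y j \<in> V"
      "\<And>j. norm (y j) > real j * (1 + norm (x j))"
    using growth by metis
  define u where "u j = (1 / norm (y j)) *\<^sub>R y j" for j
  have y_gt: "norm (y j) > real j" for j
    using xy(3)[of j] mult_left_mono[of 1 "1 + norm (x j)" "real j"] by simp
  then have y_pos: "norm (y j) > 0" for j
    using le_less_trans of_nat_0_le_iff by blast
  have norm_u: "norm (u j) = 1" for j
    using y_pos[of j] by (simp add: u_def)
  have sub: "subspace V2"
    by (rule subspace_of_complex_subspace[OF V2])
  have u_V2: "u j \<in> V2" for j
    unfolding u_def by (rule subspace_scale[OF sub xy(1)])
  have "compact (sphere (0 :: complex ^ 'n) 1)"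
    by simp
  moreover have "\<forall>j. u j \<in> sphere 0 1"
    using norm_u by simp
  ultimately obtain l r where lr: "l \<in> sphere 0 1" "strict_mono r" "(u \<circ> r) \<longlonglongrightarrow> l"
    unfolding compact_def by metis
  have l_V2: "l \<in> V2"
    using closed_sequentially[OF closed_subspace[OF sub] _ lr(3)] u_V2 by simp
  define T where "T j = norm (y (r j))" for j
  have "LIM j sequentially. real (r j) :> at_top"
    by (rule filterlim_compose[OF filterlim_real_sequentially filterlim_subseq[OF lr(2)]])
  then have "LIM j sequentially. T j :> at_top"
    by (rule filterlim_at_top_mono) (simp add: T_def y_gt less_imp_le)
  then have T: "scaling_seq T"
    using y_pos unfolding scaling_seq_def T_def by simp
  have "(\<lambda>j. (1 / T j) *\<^sub>R x (r j)) \<longlonglongrightarrow> 0"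
  proof (rule Lim_null_comparison[OF _ lim_1_over_n])
    show "\<forall>\<^sub>F j in sequentially. norm ((1 / T j) *\<^sub>R x (r j)) \<le> 1 / real j"
      \<comment> \<open>At \<open>j = 0\<close> the bound \<open>1 / real j\<close> is 0 by
        convention, so only positive \<open>j\<close> are considered.\<close>
      using eventually_gt_at_top[of 0]
    proof eventually_elim
      case (elim j)
      have "real j * norm (x (r j)) \<le> real (r j) * (1 + norm (x (r j)))"
        using seq_suble[OF lr(2), of j] by (intro mult_mono) auto
      then have "real j * norm (x (r j)) \<le> T j"
        using xy(3)[of "r j"] unfolding T_def by linarith
      then show ?case
        using elim y_pos[of "r j"] by (simp add: T_def field_simps)
    qed
  qed
  from tendsto_add[OF this lr(3)]
  have "(\<lambda>j. (1 / T j) *\<^sub>R (x (r j) + y (r j))) \<longlonglongrightarrow> l"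
    by (simp add: u_def T_def o_def scaleR_add_right)
  then have "l \<in> C_infty V"
    using xy(2) unfolding C_infty_eq[OF uniq T] tangent_cone_infty_def
    by (intro CollectI exI[of _ "\<lambda>j. x (r j) + y (r j)"]) simp
  then show ?thesis
    using l_V2 lr(1) by auto
qed

theorem theorem2p9:
  fixes V \<Omega>' :: "(complex ^ 'n::finite) set" and k :: nat
  assumes "CARD('n) \<ge> 2"
    and "\<not> bounded V"
    and "has_unique_tangent_cone_infty V"
    and "algebraic_region k \<Omega>'"
    and "C_infty V \<subseteq> \<Omega>'"
  shows "\<exists>\<Omega> :: (complex ^ 'n) set. algebraic_region k \<Omega> \<and> V \<subseteq> \<Omega> \<and> C_infty V \<subseteq> \<Omega>"
proof -
  from assms(4) obtain V1 V2 A B where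
    V1: "vec.subspace V1" and V2: "vec.subspace V2" and AB: "A > 0" "B > 0"
    and dims: "vec.dim V1 = k" "vec.dim V2 = CARD('n) - k"
    and sum: "{z' + z'' | z' z''. z' \<in> V1 \<and> z'' \<in> V2} = UNIV"
    and \<Omega>': "\<Omega>' = {z' + z'' | z' z''. z' \<in> V1 \<and> z'' \<in> V2 \<and>
                       norm z'' \<le> A * (1 + norm z') powr B}"
    unfolding algebraic_region_def by blast
  have V12: "V1 \<inter> V2 = {0}"
    using subspace_Int_trivial_of_complementary_dim[OF V1 V2 _ sum] dims by simp
  have no_unit: "norm u \<noteq> 1" if u: "u \<in> C_infty V" "u \<in> V2" for u
  proof
    assume norm_u: "norm u = 1"
    \<comment> \<open>A vector of \<open>V2\<close> has zero \<open>V1\<close> part, so its norm in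
      the region is at most \<open>A\<close>; the factor \<open>A + 1\<close> exceeds this.\<close>
    have "(A + 1) *\<^sub>R u \<in> \<Omega>'"
      using C_infty_scale[OF assms(3) u(1)] AB assms(5) by auto
    then obtain z' z'' where z: "(A + 1) *\<^sub>R u = z' + z''" "z' \<in> V1" "z'' \<in> V2"
        "norm z'' \<le> A * (1 + norm z') powr B"
      unfolding \<Omega>' by blast
    have "(A + 1) *\<^sub>R u \<in> V2"
      by (rule subspace_scale[OF subspace_of_complex_subspace[OF V2] u(2)])
    moreover have "z' = (A + 1) *\<^sub>R u - z''"
      using z(1) by simp
    ultimately have "z' \<in> V1 \<inter> V2"
      using vec.subspace_diff[OF V2 _ z(3)] z(2) by simp
    then have "z' = 0"
      using V12 by simp
    then have "norm ((A + 1) *\<^sub>R u) \<le> A"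
      using z(1,4) by simp
    then show False
      using norm_u AB by simp
  qed
  obtain j :: nat where j: "\<And>x y. x \<in> V1 \<Longrightarrow> y \<in> V2 \<Longrightarrow> x + y \<in> V \<Longrightarrow> norm y \<le> j * (1 + norm x)"
  proof -
    have "\<not> (\<forall>j::nat. \<exists>x\<in>V1. \<exists>y\<in>V2. x + y \<in> V \<and> norm y > j * (1 + norm x))"
      using tangent_vector_of_superlinear_growth[OF assms(3) V2, of V1] no_unit by blast
    then show thesis
      using that by (auto simp: not_less)
  qed
  \<comment> \<open>As \<open>1 + norm z\<close> is at least 1, raising the exponent weakens the
    bound; \<open>B'\<close> is at least 1 to absorb the linear bound on \<open>V\<close>.\<close>
  define A' B' where "A' = max A (real j)" and "B' = max B 1"
  define \<Omega> where "\<Omega> = {z' + z'' | z' z''. z' \<in> V1 \<and> z'' \<in> V2 \<and>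
                       norm z'' \<le> A' * (1 + norm z') powr B'}"
  have le: "a * (1 + norm z) powr b \<le> A' * (1 + norm z) powr B'"
    if "0 \<le> a" "a \<le> A'" "b \<le> B'" for a b and z :: "complex ^ 'n"
    using that by (intro mult_mono powr_mono) auto
  have "algebraic_region k \<Omega>"
    unfolding algebraic_region_def
    by (intro exI[of _ V1] exI[of _ V2] exI[of _ A'] exI[of _ B'] conjI V1 V2 dims sum \<Omega>_def)
       (use AB in \<open>auto simp: A'_def B'_def\<close>)
  moreover have "\<Omega>' \<subseteq> \<Omega>"
  proof -
    have "A * (1 + norm z) powr B \<le> A' * (1 + norm z) powr B'" for z :: "complex ^ 'n"
      using AB by (intro le) (auto simp: A'_def B'_def)
    then show ?thesis
      unfolding \<Omega>' \<Omega>_def by (blast intro: order_trans)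
  qed
  moreover have "V \<subseteq> \<Omega>"
  proof
    fix v assume v: "v \<in> V"
    obtain x y where xy: "v = x + y" "x \<in> V1" "y \<in> V2"
      using sum by blast
    \<comment> \<open>The exponent 1 is written out so that \<open>le\<close> applies with
      \<open>b = 1\<close>.\<close>
    have "norm y \<le> real j * (1 + norm x) powr 1"
      using j[OF xy(2,3)] v xy(1) by simp
    also have "\<dots> \<le> A' * (1 + norm x) powr B'"
      by (rule le) (auto simp: A'_def B'_def)
    finally show "v \<in> \<Omega>"
      using xy unfolding \<Omega>_def by blast
  qed
  ultimately show ?thesis
    using assms(5) by blast
qed

end
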